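(* Let $G$ be an infinite finitely generated group and let $X\subseteq\mathrm{Lip}_0(G)$ be an invariant linear subspace. Then $X$ is pointwise closed if and only if there exists a sequence $(x_n)_n\subseteq\mathbb{R}[G]$ such that $$\tilde X=\big(\mathrm{Lip}_0(G)\oplus\mathrm{constants}\big)\cap\bigcap_n\ker(P_{x_n}),$$ where $\ker(P_x)=\{f\in\mathbb{R}^G: P_x(f)=0\}$.
   Context: Fix a finite symmetric generating set $S$ of $G$; $G$ is viewed as its Cayley graph with edges $(g,gs)$, $g\in G$, $s\in S$, with the associated graph (word) metric $d$ and distinguished vertex $1_G$ (also written $0$). $\mathrm{Lip}_0(G)$ is the Banach space of Lipschitz functions $f:G\to\mathbb{R}$ with $f(1_G)=0$, normed by the optimal Lipschitz constant. For $g\in G$, $f\in\mathrm{Lip}_0(G)$, $(g\cdot f)(x)=f(g^{-1}x)-f(g^{-1})$; a linear subspace $X$ is invariant if $g\cdot X=X$ for all $g\in G$. It is pointwise closed if it is closed in $\mathrm{Lip}_0(G)$ for pointwise convergence. $\mathrm{constants}$ is the one-dimensional space of constant real functions on $G$; $\mathrm{Lip}_0(G)\oplus\mathrm{constants}$ is regarded as the space of all real Lipschitz functions on $G$. For an invariant subspace $X\subseteq\mathrm{Lip}_0(G)$, $\tilde X:=X\oplus\mathrm{constants}\subseteq\mathrm{Lip}_0(G)\oplus\mathrm{constants}$. $\mathbb{R}[G]$ is the real group algebra, viewed as the finitely supported functions in $\mathbb{R}^G$. For $x\in\mathbb{R}[G]$ and $f\in\mathbb{R}^G$, $(f\star x)(g)=\sum_{h\in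 G}f(gh^{-1})x(h)$, and $P_x:\mathbb{R}^G\to\mathbb{R}^G$ is $P_x(f)=f\star x$. *)

theory Defs
  imports
    "HOL-Analysis.Analysis"
    "HOL-Algebra.Generated_Groups"
    "HOL-Library.Function_Algebras"
    "HOL-Library.Set_Algebras"
begin

instantiation "fun" :: (type, real_vector) real_vector
begin

definition scaleR_fun :: "real \<Rightarrow> ('a \<Rightarrow> 'b) \<Rightarrow> 'a \<Rightarrow> 'b" where
  "scaleR_fun c f = (\<lambda>x. c *\<^sub>R f x)"

instance
  by standard (auto simp: scaleR_fun_def fun_eq_iff scaleR_add_right scaleR_add_left)

end

text \<open>
  A real function on a group \<open>G\<close> is represented by the function on the underlying type that is
  \<open>0\<close> off the carrier. The space of all of them is thus a linear subspace of
  \<open>'a \<Rightarrow> real\<close>, on which the library's topology on functions (the product topology) induces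
  the topology of pointwise convergence on \<open>G\<close>.
\<close>

definition real_functions :: "('a, 'b) monoid_scheme \<Rightarrow> ('a \<Rightarrow> real) set" where
  "real_functions G = {f. \<forall>g. g \<notin> carrier G \<longrightarrow> f g = 0}"

definition symmetric_generating_set :: "('a, 'b) monoid_scheme \<Rightarrow> 'a set \<Rightarrow> bool" where
  "symmetric_generating_set G S \<longleftrightarrow>
     S \<subseteq> carrier G \<and> (\<forall>s\<in>S. inv\<^bsub>G\<^esub> s \<in> S) \<and> generate G S = carrier G"

definition cayley_edges :: "('a, 'b) monoid_scheme \<Rightarrow> 'a set \<Rightarrow> ('a \<times> 'a) set" where
  "cayley_edges G S = {(g, g \<otimes>\<^bsub>G\<^esub> s) | g s. g \<in> carrier G \<and> s \<in> S}"

text \<open>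
  The graph metric: the least length of an edge path. Such a path exists between any two
  elements of the carrier when \<open>S\<close> is a symmetric generating set.
\<close>

definition cayley_dist :: "('a, 'b) monoid_scheme \<Rightarrow> 'a set \<Rightarrow> 'a \<Rightarrow> 'a \<Rightarrow> nat" where
  "cayley_dist G S g h = (LEAST n. (g, h) \<in> cayley_edges G S ^^ n)"

definition Lip0 :: "('a, 'b) monoid_scheme \<Rightarrow> 'a set \<Rightarrow> ('a \<Rightarrow> real) set" where
  "Lip0 G S = {f \<in> real_functions G. f \<one>\<^bsub>G\<^esub> = 0 \<and>
     (\<exists>C. \<forall>g\<in>carrier G. \<forall>h\<in>carrier G. \<bar>f g - f h\<bar> \<le> C * real (cayley_dist G S g h))}"

definition translate :: "('a, 'b) monoid_scheme \<Rightarrow> 'a \<Rightarrow> ('a \<Rightarrow> real) \<Rightarrow> 'a \<Rightarrow> real" where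
  "translate G g f = (\<lambda>x. if x \<in> carrier G
     then f (inv\<^bsub>G\<^esub> g \<otimes>\<^bsub>G\<^esub> x) - f (inv\<^bsub>G\<^esub> g) else 0)"

definition invariant :: "('a, 'b) monoid_scheme \<Rightarrow> ('a \<Rightarrow> real) set \<Rightarrow> bool" where
  "invariant G X \<longleftrightarrow> (\<forall>g\<in>carrier G. translate G g ` X = X)"

definition constants :: "('a, 'b) monoid_scheme \<Rightarrow> ('a \<Rightarrow> real) set" where
  "constants G = {(\<lambda>g. if g \<in> carrier G then c else 0) | c. True}"

text \<open>
  The pointwise sum of subspaces; it is direct for \<open>X \<subseteq> Lip0 G S\<close>, whose elements vanish
  at the identity.
\<close>

definition with_constants ::
    "('a, 'b) monoid_scheme \<Rightarrow> ('a \<Rightarrow> real) set \<Rightarrow> ('a \<Rightarrow> real) set" where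
  "with_constants G X = X + constants G"

definition group_algebra :: "('a, 'b) monoid_scheme \<Rightarrow> ('a \<Rightarrow> real) set" where
  "group_algebra G = {x \<in> real_functions G. finite {g \<in> carrier G. x g \<noteq> 0}}"

text \<open>The sum ranges over the support of \<open>x\<close>, since the sum over an infinite set is \<open>0\<close>.\<close>

definition convolution ::
    "('a, 'b) monoid_scheme \<Rightarrow> ('a \<Rightarrow> real) \<Rightarrow> ('a \<Rightarrow> real) \<Rightarrow> 'a \<Rightarrow> real" where
  "convolution G f x = (\<lambda>g. if g \<in> carrier G
     then \<Sum>h\<in>{h \<in> carrier G. x h \<noteq> 0}. f (g \<otimes>\<^bsub>G\<^esub> inv\<^bsub>G\<^esub> h) * x h else 0)"

definition kernel_P :: "('a, 'b) monoid_scheme \<Rightarrow> ('a \<Rightarrow> real) \<Rightarrow> ('a \<Rightarrow> real) set" where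
  "kernel_P G x = {f \<in> real_functions G. convolution G f x = 0}"

definition pointwise_closed ::
    "('a, 'b) monoid_scheme \<Rightarrow> 'a set \<Rightarrow> ('a \<Rightarrow> real) set \<Rightarrow> bool" where
  "pointwise_closed G S X \<longleftrightarrow> closedin (top_of_set (Lip0 G S)) X"

end

theory Submission
  imports Defs
begin

text \<open>
  Write \<open>X~\<close> for \<open>with_constants G X\<close>. The point is that finitely supported functions
  are exactly the continuous linear functionals on real functions with the topology of pointwise
  convergence, and that \<open>f \<mapsto> (f \<star> x)(g)\<close> is such a functional.

  A common kernel is therefore closed. As a function in \<open>Lip0 G S\<close> lies in \<open>X~\<close> only if it lies
  in \<open>X\<close>, intersecting both sides of the claimed equation with \<open>Lip0 G S\<close> exhibits \<open>X\<close> as a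
  relatively closed set (\<open>common_kernel_pointwise_closed\<close>).

  Conversely, let \<open>A\<close> consist of all \<open>x\<close> in the group algebra with \<open>v \<star> x = 0\<close> for every
  \<open>v \<in> X~\<close>. Adding the constants turns the normalised action on \<open>X\<close> into plain left translation
  on \<open>X~\<close>, so a functional that kills \<open>X~\<close> also kills all its translates; thus the functionals
  vanishing on \<open>X~\<close> are precisely the evaluations \<open>f \<mapsto> (f \<star> x)(\<one>)\<close> with \<open>x \<in> A\<close>. Instead of
  the Hahn-Banach theorem, a finite-dimensional duality argument suffices: if \<open>f \<star> x = 0\<close> for all
  \<open>x \<in> A\<close>, then on each finite subset of \<open>G\<close> some element of \<open>X~\<close> agrees with \<open>f\<close> exactly
  (\<open>annihilated_imp_interpolated\<close>). After subtracting constants this puts \<open>f - f(\<one>)\<close> into the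
  pointwise closure of \<open>X\<close>, hence into \<open>X\<close> (\<open>closed_invariant_annihilated\<close>).

  It remains to replace \<open>A\<close> by a sequence. The group is countable, and the elements of \<open>A\<close>
  supported in a given finite set form a finite-dimensional space; the bases of these countably
  many spaces span \<open>A\<close> (\<open>group_algebra_countable_span\<close>), and \<open>f \<star> x\<close> is linear in \<open>x\<close>.
\<close>

lemma scaleR_fun_apply [simp]: "(c *\<^sub>R f) x = c *\<^sub>R f x"
  by (simp add: scaleR_fun_def)

section \<open>Interpolation and pointwise closure\<close>

text \<open>
  Finite-dimensional duality: the restriction of \<open>f\<close> to \<open>F\<close> lies in the space of restrictions of
  \<open>V\<close> as soon as every functional on \<open>\<real>\<^sup>F\<close> that kills this space kills \<open>f\<close>. Keeping \<open>V\<close> as a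
  space of functions on the whole type allows an induction on \<open>F\<close> without any change of carrier:
  a point \<open>a\<close> is removed by passing to the subspace of \<open>V\<close> of functions vanishing at \<open>a\<close>.
\<close>
lemma subspace_interpolates_on_finite:
  fixes V :: "('a \<Rightarrow> real) set"
  assumes "finite F" and "subspace V"
    and "\<And>y. (\<And>v. v \<in> V \<Longrightarrow> (\<Sum>k\<in>F. v k * y k) = 0) \<Longrightarrow> (\<Sum>k\<in>F. f k * y k) = 0"
  shows "\<exists>v\<in>V. \<forall>k\<in>F. v k = f k"
  using assms
proof (induction F arbitrary: V f rule: finite_induct)
  case empty
  then show ?case using subspace_0 by blast
next
  case (insert a F)
  note V = \<open>subspace V\<close>
  show ?case
  proof (cases "\<forall>v\<in>V. v a = 0")
    case True
    have not_a: "k \<noteq> a" if "k \<in> F" for k using that insert.hyps by blast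
    \<comment> \<open>Evaluation at \<open>a\<close> is itself a functional that kills \<open>V\<close>.\<close>
    have "f a = 0"
      using insert.prems(2)[of "\<lambda>k. if k = a then 1 else 0"] True insert.hyps
      by (simp add: if_distrib sum.delta cong: if_cong)
    have "\<exists>v\<in>V. \<forall>k\<in>F. v k = f k"
    proof (rule insert.IH[OF V])
      fix y assume y: "\<And>v. v \<in> V \<Longrightarrow> (\<Sum>k\<in>F. v k * y k) = 0"
      show "(\<Sum>k\<in>F. f k * y k) = 0"
        using insert.prems(2)[of y] y True \<open>f a = 0\<close> insert.hyps by simp
    qed
    then show ?thesis using True \<open>f a = 0\<close> by auto
  next
    case False
    then obtain u where u: "u \<in> V" "u a \<noteq> 0" by blast
    define w where "w = inverse (u a) *\<^sub>R u"
    have w: "w \<in> V" "w a = 1"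
      using u subspace_scale[OF V] by (auto simp: w_def)
    define V0 where "V0 = {v \<in> V. v a = 0}"
    have V0: "subspace V0"
      using V by (auto simp: V0_def subspace_def)
    have "\<exists>v\<in>V0. \<forall>k\<in>F. v k = (f - f a *\<^sub>R w) k"
    proof (rule insert.IH[OF V0])
      fix y assume y: "\<And>v. v \<in> V0 \<Longrightarrow> (\<Sum>k\<in>F. v k * y k) = 0"
      \<comment> \<open>A functional on \<open>F\<close> is extended by the value at \<open>a\<close> that makes it kill \<open>w\<close>; it then
        factors through the projection \<open>h \<mapsto> h - h(a) w\<close> of \<open>V\<close> onto \<open>V0\<close>.\<close>
      define z where "z = y(a := - (\<Sum>k\<in>F. w k * y k))"
      have pair: "(\<Sum>k\<in>insert a F. h k * z k) = (\<Sum>k\<in>F. (h - h a *\<^sub>R w) k * y k)" for h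
      proof -
        have "(\<Sum>k\<in>F. h k * z k) = (\<Sum>k\<in>F. h k * y k)"
          using insert.hyps by (intro sum.cong) (auto simp: z_def)
        then show ?thesis
          using insert.hyps
          by (simp add: z_def left_diff_distrib sum_subtractf sum_distrib_left mult.assoc)
      qed
      have "(\<Sum>k\<in>insert a F. v k * z k) = 0" if "v \<in> V" for v
      proof -
        have "v - v a *\<^sub>R w \<in> V0"
          using that w subspace_diff[OF V] subspace_scale[OF V] by (auto simp: V0_def)
        then show ?thesis using y by (simp only: pair)
      qed
      from insert.prems(2)[OF this] show "(\<Sum>k\<in>F. (f - f a *\<^sub>R w) k * y k) = 0"
        by (simp only: pair)
    qed
    then obtain v where v: "v \<in> V0" "\<forall>k\<in>F. v k = (f - f a *\<^sub>R w) k" by blast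
    have "v + f a *\<^sub>R w \<in> V"
      using v w subspace_add[OF V] subspace_scale[OF V] by (auto simp: V0_def)
    moreover have "\<forall>k\<in>insert a F. (v + f a *\<^sub>R w) k = f k"
      using v w by (auto simp: V0_def)
    ultimately show ?thesis by blast
  qed
qed

text \<open>
  A basic neighbourhood in the product topology constrains only finitely many coordinates, so
  agreement with \<open>f\<close> on these coordinates already means membership in the neighbourhood.
\<close>
lemma closed_contains_finite_interpolated:
  fixes T :: "('a \<Rightarrow> 'b::topological_space) set"
  assumes "closed T"
    and approx: "\<And>F. finite F \<Longrightarrow> \<exists>v\<in>T. \<forall>k\<in>F. v k = f k"
  shows "f \<in> T"
proof (rule ccontr)
  assume "f \<notin> T"
  moreover have "openin (product_topology (\<lambda>_. euclidean) UNIV) (- T)"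
    using \<open>closed T\<close> by (simp add: open_fun_def[symmetric] open_Compl)
  ultimately obtain U where U: "f \<in> (\<Pi>\<^sub>E i\<in>UNIV. U i)" "finite {i. U i \<noteq> UNIV}"
      "(\<Pi>\<^sub>E i\<in>UNIV. U i) \<subseteq> - T"
    using product_topology_open_contains_basis[of "\<lambda>_. euclidean" UNIV "- T" f]
    by auto
  obtain v where v: "v \<in> T" "\<forall>k\<in>{i. U i \<noteq> UNIV}. v k = f k"
    using approx[OF U(2)] by blast
  have "v k \<in> U k" for k
  proof (cases "U k = UNIV")
    case False
    then have "v k = f k" using v by blast
    then show ?thesis using U(1) by (metis PiE_mem UNIV_I)
  qed simp
  then have "v \<in> (\<Pi>\<^sub>E i\<in>UNIV. U i)" by (simp add: PiE_UNIV_domain)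
  with U(3) v(1) show False by blast
qed

section \<open>The group algebra\<close>

context group
begin

text \<open>
  Every element of the generated subgroup is the product of a finite word in the generators and
  their inverses, and there are only countably many such words.
\<close>
lemma generate_countable:
  assumes "S \<subseteq> carrier G" "countable S"
  shows "countable (generate G S)"
proof -
  define S' where "S' = S \<union> (\<lambda>s. inv s) ` S"
  have "countable S'" using assms by (simp add: S'_def)
  have S': "S' \<subseteq> carrier G" using assms by (auto simp: S'_def)
  define P where "P = (\<lambda>l. foldr (\<otimes>) l \<one>)"
  have P_closed: "P l \<in> carrier G" if "l \<in> lists S'" for l
    using that S' by (induction l) (auto simp: P_def)
  have P_append: "P (l @ m) = P l \<otimes> P m" if "l \<in> lists S'" "m \<in> lists S'" for l m
    using that
  proof (induction l)
    case Nil
    then show ?case using P_closed[of m] by (simp add: P_def)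
  next
    case (Cons s l)
    then have "s \<in> carrier G" "P l \<in> carrier G" "P m \<in> carrier G"
      using S' P_closed by auto
    with Cons show ?case by (simp add: P_def m_assoc)
  qed
  have single: "s \<in> P ` lists S'" if "s \<in> S'" for s
    using that S' by (intro image_eqI[of _ _ "[s]"]) (auto simp: P_def)
  have "g \<in> P ` lists S'" if "g \<in> generate G S" for g
    using that
  proof (induction rule: generate.induct)
    case one
    show ?case by (intro image_eqI[of _ _ "[]"]) (auto simp: P_def)
  next
    case (incl h)
    then show ?case by (intro single) (simp add: S'_def)
  next
    case (inv h)
    then show ?case by (intro single) (simp add: S'_def)
  next
    case (eng h1 h2)
    then obtain l m where "l \<in> lists S'" "m \<in> lists S'" "h1 = P l" "h2 = P m" by blast
    then show ?case by (intro image_eqI[of _ _ "l @ m"]) (auto simp: P_append)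
  qed
  then show ?thesis
    using \<open>countable S'\<close> by (meson countable_image countable_lists countable_subset subsetI)
qed

text \<open>
  This is what makes a sequence sufficient to describe any annihilator. The subspace \<open>A\<close> is the
  union of its parts \<open>A_on F\<close> of elements supported in a finite set \<open>F\<close>. Each part sits in the
  span of the finitely many point masses \<open>\<delta> k\<close> with \<open>k \<in> F\<close>, so it has a finite basis, and there are
  only countably many \<open>F\<close>.
\<close>
lemma group_algebra_countable_span:
  assumes "countable (carrier G)" and "subspace A" and "A \<subseteq> group_algebra G"
  shows "\<exists>x :: nat \<Rightarrow> 'a \<Rightarrow> real. range x \<subseteq> A \<and> A \<subseteq> span (range x)"
proof -
  define A_on where "A_on = (\<lambda>F. {x \<in> A. \<forall>g. g \<notin> F \<longrightarrow> x g = 0})"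
  define \<F> where "\<F> = {F. finite F \<and> F \<subseteq> carrier G}"
  have "\<exists>B. B \<subseteq> A_on F \<and> A_on F \<subseteq> span B \<and> finite B" if "F \<in> \<F>" for F
  proof -
    define \<delta> where "\<delta> = (\<lambda>k g::'a. if g = k then 1 else 0 :: real)"
    have F: "finite F" using that by (simp add: \<F>_def)
    have "x \<in> span (\<delta> ` F)" if "x \<in> A_on F" for x
    proof -
      have "x = (\<Sum>k\<in>F. x k *\<^sub>R \<delta> k)"
      proof
        fix g
        have *: "(\<Sum>k\<in>T. x k *\<^sub>R \<delta> k) g = (\<Sum>k\<in>T. x k * \<delta> k g)" for T
          by (induction T rule: infinite_finite_induct) auto
        show "x g = (\<Sum>k\<in>F. x k *\<^sub>R \<delta> k) g"
          unfolding * using that F by (auto simp: A_on_def \<delta>_def if_distrib cong: if_cong)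
      qed
      also have "\<dots> \<in> span (\<delta> ` F)"
        by (intro span_sum span_scale span_base) auto
      finally show ?thesis .
    qed
    then have sub: "A_on F \<subseteq> span (\<delta> ` F)" by blast
    obtain B where B: "B \<subseteq> A_on F" "independent B" "A_on F \<subseteq> span B"
      by (rule real_vector.basis_exists)
    have "finite B"
      using real_vector.independent_span_bound[of "\<delta> ` F" B] B(1,2) sub F
      by (metis finite_imageI subset_trans)
    with B show ?thesis by blast
  qed
  then obtain B where B: "\<And>F. F \<in> \<F> \<Longrightarrow> B F \<subseteq> A_on F \<and> A_on F \<subseteq> span (B F) \<and> finite (B F)"
    by metis
  \<comment> \<open>The zero vector guarantees that \<open>C\<close> can be enumerated even if all the bases are empty.\<close>
  define C where "C = insert 0 (\<Union>F\<in>\<F>. B F)"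
  have "countable \<F>"
    unfolding \<F>_def using countable_Collect_finite_subset[OF assms(1)] by (simp add: conj_commute)
  then have "countable C" using B by (auto simp: C_def intro: countable_finite)
  moreover have "C \<noteq> {}" by (simp add: C_def)
  ultimately have range: "range (from_nat_into C) = C" by (rule range_from_nat_into[rotated])
  have "C \<subseteq> A"
    using B subspace_0[OF assms(2)] by (auto simp: C_def A_on_def)
  moreover have "A \<subseteq> span C"
  proof
    fix x assume "x \<in> A"
    then have x: "x \<in> group_algebra G" using assms by blast
    define F where "F = {g \<in> carrier G. x g \<noteq> 0}"
    have "F \<in> \<F>" using x by (auto simp: F_def \<F>_def group_algebra_def)
    moreover have "x \<in> A_on F"
      using x \<open>x \<in> A\<close> by (auto simp: F_def A_on_def group_algebra_def real_functions_def)
    ultimately have "x \<in> span (B F)" using B by blast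
    also have "span (B F) \<subseteq> span C"
      using \<open>F \<in> \<F>\<close> by (intro span_mono) (auto simp: C_def)
    finally show "x \<in> span C" .
  qed
  ultimately show ?thesis using range by metis
qed

text \<open>
  Summing over a set that may exceed the support of \<open>x\<close> allows convolutions with different
  elements of the group algebra to be compared term by term.
\<close>
lemma convolution_eq_sum:
  assumes "finite T" "T \<subseteq> carrier G" "\<And>h. h \<in> carrier G \<Longrightarrow> h \<notin> T \<Longrightarrow> x h = 0"
    and "g \<in> carrier G"
  shows "convolution G f x g = (\<Sum>h\<in>T. f (g \<otimes> inv h) * x h)"
  using assms unfolding convolution_def
  by (auto intro!: sum.mono_neutral_left)

lemma group_algebra_convolution_subspace:
  "subspace {x \<in> group_algebra G. convolution G f x = 0}"
proof (rule subspaceI)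
  show "0 \<in> {x \<in> group_algebra G. convolution G f x = 0}"
    by (auto simp: group_algebra_def real_functions_def convolution_def fun_eq_iff)
next
  fix x y assume xy: "x \<in> {x \<in> group_algebra G. convolution G f x = 0}"
    "y \<in> {x \<in> group_algebra G. convolution G f x = 0}"
  define T where "T = {g \<in> carrier G. x g \<noteq> 0} \<union> {g \<in> carrier G. y g \<noteq> 0}"
  have T: "finite T" "T \<subseteq> carrier G"
    using xy by (auto simp: T_def group_algebra_def)
  have "finite {g \<in> carrier G. (x + y) g \<noteq> 0}"
    by (rule finite_subset[OF _ T(1)]) (auto simp: T_def)
  then have "x + y \<in> group_algebra G"
    using xy by (simp add: group_algebra_def real_functions_def)
  moreover have "convolution G f (x + y) g = convolution G f x g + convolution G f y g" for g
  proof (cases "g \<in> carrier G")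
    case True
    then show ?thesis
      by (subst (1 2 3) convolution_eq_sum[OF T])
         (auto simp: T_def distrib_left sum.distrib)
  qed (simp add: convolution_def)
  ultimately show "x + y \<in> {x \<in> group_algebra G. convolution G f x = 0}"
    using xy by (auto simp: fun_eq_iff)
next
  fix c x assume x: "x \<in> {x \<in> group_algebra G. convolution G f x = 0}"
  define T where "T = {g \<in> carrier G. x g \<noteq> 0}"
  have T: "finite T" "T \<subseteq> carrier G"
    using x by (auto simp: T_def group_algebra_def)
  have "finite {g \<in> carrier G. (c *\<^sub>R x) g \<noteq> 0}"
    by (rule finite_subset[OF _ T(1)]) (auto simp: T_def)
  then have "c *\<^sub>R x \<in> group_algebra G"
    using x by (simp add: group_algebra_def real_functions_def)
  moreover have "convolution G f (c *\<^sub>R x) g = c * convolution G f x g" for g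
  proof (cases "g \<in> carrier G")
    case True
    then show ?thesis
      by (subst (1 2) convolution_eq_sum[OF T])
         (auto simp: T_def sum_distrib_left mult.left_commute)
  qed (simp add: convolution_def)
  ultimately show "c *\<^sub>R x \<in> {x \<in> group_algebra G. convolution G f x = 0}"
    using x by (auto simp: fun_eq_iff)
qed

text \<open>
  Each value of \<open>f \<star> x\<close> is a finite linear combination of values of \<open>f\<close>, hence continuous in \<open>f\<close>
  for pointwise convergence.
\<close>
lemma closed_convolution_zero: "closed {f. convolution G f x = 0}"
proof -
  have "continuous_on UNIV (\<lambda>f. convolution G f x g)" for g
    by (cases "g \<in> carrier G")
       (auto simp: convolution_def intro!: continuous_intros continuous_on_product_coordinates)
  then have "closed {f. convolution G f x g = 0}" for g
    by (intro closed_Collect_eq) auto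
  then have "closed (\<Inter>g. {f. convolution G f x g = 0})" by blast
  moreover have "(\<Inter>g. {f. convolution G f x g = 0}) = {f. convolution G f x = 0}"
    by (auto simp: fun_eq_iff)
  ultimately show ?thesis by simp
qed

section \<open>Adding the constants\<close>

text \<open>
  Since elements of \<open>X\<close> vanish at the identity, the constant part of a function in \<open>X~\<close> can only be
  its value there. The explicit decomposition takes the place of working with a direct sum.
\<close>
lemma with_constants_mem_iff:
  assumes "X \<subseteq> Lip0 G S"
  shows "f \<in> with_constants G X \<longleftrightarrow>
    f \<in> real_functions G \<and> (\<lambda>k. if k \<in> carrier G then f k - f \<one> else 0) \<in> X"
proof
  assume "f \<in> with_constants G X"
  then obtain u c where u: "u \<in> X" and f: "f = u + (\<lambda>g. if g \<in> carrier G then c else 0)"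
    by (auto simp: with_constants_def constants_def elim!: set_plus_elim)
  have "u \<in> real_functions G" "u \<one> = 0" using u assms by (auto simp: Lip0_def)
  then have "(\<lambda>k. if k \<in> carrier G then f k - f \<one> else 0) = u" "f \<in> real_functions G"
    by (auto simp: f fun_eq_iff real_functions_def)
  with u show "f \<in> real_functions G \<and> (\<lambda>k. if k \<in> carrier G then f k - f \<one> else 0) \<in> X"
    by simp
next
  let ?u = "\<lambda>k. if k \<in> carrier G then f k - f \<one> else 0"
  assume f: "f \<in> real_functions G \<and> ?u \<in> X"
  then have "f = ?u + (\<lambda>g. if g \<in> carrier G then f \<one> else 0)"
    by (auto simp: fun_eq_iff real_functions_def)
  moreover have "(\<lambda>g. if g \<in> carrier G then f \<one> else 0) \<in> constants G"
    by (auto simp: constants_def)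
  ultimately have "?u + (\<lambda>g. if g \<in> carrier G then f \<one> else 0) \<in> with_constants G X"
    unfolding with_constants_def using f by (intro set_plus_intro) auto
  then show "f \<in> with_constants G X"
    by (subst \<open>f = _\<close>)
qed

lemma Lip0_basepoint_iff:
  assumes "X \<subseteq> Lip0 G S" "f \<in> Lip0 G S"
  shows "f \<in> with_constants G X \<longleftrightarrow> f \<in> X"
proof -
  have "(\<lambda>k. if k \<in> carrier G then f k - f \<one> else 0) = f"
    using assms by (auto simp: Lip0_def real_functions_def fun_eq_iff)
  then show ?thesis using assms by (auto simp: with_constants_mem_iff Lip0_def)
qed

lemma with_constants_subspace:
  assumes "subspace X"
  shows "subspace (with_constants G X)"
proof -
  have "subspace (constants G)"
  proof (rule subspaceI)
    show "0 \<in> constants G" by (auto simp: constants_def fun_eq_iff)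
  next
    fix x y assume "x \<in> constants G" "y \<in> constants G"
    then obtain c d where "x = (\<lambda>g. if g \<in> carrier G then c else 0)"
      "y = (\<lambda>g. if g \<in> carrier G then d else 0)" by (auto simp: constants_def)
    then show "x + y \<in> constants G"
      by (auto simp: constants_def fun_eq_iff intro!: exI[of _ "c + d"])
  next
    fix a x assume "x \<in> constants G"
    then obtain c where "x = (\<lambda>g. if g \<in> carrier G then c else 0)" by (auto simp: constants_def)
    then show "a *\<^sub>R x \<in> constants G"
      by (auto simp: constants_def fun_eq_iff intro!: exI[of _ "a * c"])
  qed
  then have "subspace {x + y |x y. x \<in> X \<and> y \<in> constants G}"
    using assms real_vector.subspace_sums by blast
  moreover have "{x + y |x y. x \<in> X \<and> y \<in> constants G} = X + constants G"
    by (auto simp: set_plus_def)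
  ultimately show ?thesis by (simp add: with_constants_def)
qed

text \<open>
  The action on \<open>X\<close> is left translation corrected by a constant to restore the value \<open>0\<close> at the
  identity; the constants in \<open>X~\<close> absorb this correction.
\<close>
lemma with_constants_translate:
  assumes "X \<subseteq> Lip0 G S" "invariant G X" "v \<in> with_constants G X" "g \<in> carrier G"
  shows "(\<lambda>k. if k \<in> carrier G then v (g \<otimes> k) else 0) \<in> with_constants G X"
proof -
  let ?u = "\<lambda>k. if k \<in> carrier G then v k - v \<one> else 0"
  have "?u \<in> X" using assms with_constants_mem_iff by blast
  then have "translate G (inv g) ?u \<in> X"
    using assms(2,4) by (auto simp: invariant_def)
  moreover have "translate G (inv g) ?u =
      (\<lambda>k. if k \<in> carrier G then v (g \<otimes> k) - v (g \<otimes> \<one>) else 0)"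
    using assms(4) by (auto simp: translate_def fun_eq_iff)
  ultimately show ?thesis
    using assms(1) by (simp add: with_constants_mem_iff real_functions_def cong: if_cong)
qed

section \<open>Closed invariant subspaces as common kernels\<close>

text \<open>
  Elements of the group algebra whose whole convolution with each \<open>v \<in> V\<close> vanishes, rather than only
  its value at the identity. For translation-invariant \<open>V\<close> both conditions are equivalent.
\<close>
definition annihilator :: "('a \<Rightarrow> real) set \<Rightarrow> ('a \<Rightarrow> real) set" where
  "annihilator V = {x \<in> group_algebra G. V \<subseteq> kernel_P G x}"

lemma annihilator_subspace:
  assumes "V \<subseteq> real_functions G"
  shows "subspace (annihilator V)"
proof -
  have "annihilator V =
      (\<Inter>f\<in>insert 0 V. {x \<in> group_algebra G. convolution G f x = 0})"
    using assms by (auto simp: annihilator_def kernel_P_def convolution_def fun_eq_iff)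
  then show ?thesis
    by (simp only: real_vector.subspace_Int[OF group_algebra_convolution_subspace])
qed

text \<open>
  A functional \<open>y\<close> on \<open>\<real>\<^sup>F\<close> is the evaluation at the identity of convolution with the element
  \<open>x(h) = y(h\<^sup>-\<^sup>1)\<close>. If it kills \<open>V\<close>, invariance of \<open>V\<close> shows that \<open>v \<star> x\<close> vanishes at every \<open>g\<close>, since
  its value there is \<open>y\<close> applied to the translate \<open>k \<mapsto> v(g k)\<close>. So \<open>x\<close> is in the annihilator,
  hence kills \<open>f\<close>, and the duality on the finite set \<open>F\<close> applies.
\<close>
lemma annihilated_imp_interpolated:
  fixes V :: "('a \<Rightarrow> real) set"
  assumes "subspace V" and "V \<subseteq> real_functions G"
    and trans: "\<And>v g. v \<in> V \<Longrightarrow> g \<in> carrier G \<Longrightarrow>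
      (\<lambda>k. if k \<in> carrier G then v (g \<otimes> k) else 0) \<in> V"
    and f: "\<And>x. x \<in> annihilator V \<Longrightarrow> convolution G f x = 0"
    and F: "finite F" "F \<subseteq> carrier G"
  shows "\<exists>v\<in>V. \<forall>k\<in>F. v k = f k"
proof (rule subspace_interpolates_on_finite[OF F(1) assms(1)])
  fix y assume y: "\<And>v. v \<in> V \<Longrightarrow> (\<Sum>k\<in>F. v k * y k) = 0"
  define x where "x = (\<lambda>h. if h \<in> carrier G \<and> inv h \<in> F then y (inv h) else 0)"
  define T where "T = (\<lambda>k. inv k) ` F"
  have T: "finite T" "T \<subseteq> carrier G" using F by (auto simp: T_def)
  have supp: "x h = 0" if "h \<notin> T" for h
    using that F by (auto simp: x_def T_def image_iff)
  have conv: "convolution G h x g = (\<Sum>k\<in>F. h (g \<otimes> k) * y k)" if "g \<in> carrier G" for h g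
  proof -
    have "convolution G h x g = (\<Sum>k\<in>T. h (g \<otimes> inv k) * x k)"
      using that supp by (intro convolution_eq_sum[OF T]) auto
    also have "\<dots> = (\<Sum>k\<in>F. h (g \<otimes> inv (inv k)) * x (inv k))"
      unfolding T_def using F inv_inj by (subst sum.reindex) (auto intro: inj_on_subset)
    also have "\<dots> = (\<Sum>k\<in>F. h (g \<otimes> k) * y k)"
      using F by (intro sum.cong) (auto simp: x_def subset_iff)
    finally show ?thesis .
  qed
  have "finite {g \<in> carrier G. x g \<noteq> 0}"
    using supp by (intro finite_subset[OF _ T(1)]) auto
  then have "x \<in> group_algebra G"
    by (simp add: group_algebra_def real_functions_def x_def)
  moreover have "v \<in> kernel_P G x" if "v \<in> V" for v
  proof -
    have "convolution G v x g = 0" for g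
    proof (cases "g \<in> carrier G")
      case True
      have "(\<Sum>k\<in>F. (if k \<in> carrier G then v (g \<otimes> k) else 0) * y k) = 0"
        by (rule y[OF trans[OF that True]])
      moreover have "(\<Sum>k\<in>F. (if k \<in> carrier G then v (g \<otimes> k) else 0) * y k)
          = (\<Sum>k\<in>F. v (g \<otimes> k) * y k)"
        using F by (intro sum.cong) auto
      ultimately show ?thesis using True by (simp add: conv)
    qed (simp add: convolution_def)
    then show ?thesis using that assms(2) by (auto simp: kernel_P_def fun_eq_iff)
  qed
  ultimately have "convolution G f x \<one> = 0" by (simp add: annihilator_def f subset_iff)
  moreover have "(\<Sum>k\<in>F. f (\<one> \<otimes> k) * y k) = (\<Sum>k\<in>F. f k * y k)"
    using F by (intro sum.cong) auto
  ultimately show "(\<Sum>k\<in>F. f k * y k) = 0" by (simp add: conv)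
qed

text \<open>
  The double annihilator of \<open>X~\<close> within the Lipschitz functions is \<open>X~\<close> itself. The interpolation is
  carried out in \<open>X~\<close>, which is where invariance gives annihilators, but closedness is only known
  for \<open>X\<close>; the two are reconciled by interpolating at the identity as well, which forces the
  constant parts of \<open>f\<close> and of the interpolant to coincide.
\<close>
lemma closed_invariant_annihilated:
  assumes X: "X \<subseteq> Lip0 G S" "subspace X" "invariant G X" "pointwise_closed G S X"
    and f: "f \<in> with_constants G (Lip0 G S)"
    and ann: "\<And>x. x \<in> annihilator (with_constants G X) \<Longrightarrow> convolution G f x = 0"
  shows "f \<in> with_constants G X"
proof -
  let ?V = "with_constants G X"
  define f0 where "f0 = (\<lambda>k. if k \<in> carrier G then f k - f \<one> else 0)"
  have f': "f \<in> real_functions G" and f0: "f0 \<in> Lip0 G S"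
    using f by (auto simp: with_constants_mem_iff[OF order_refl] f0_def)
  obtain T where T: "closed T" "X = Lip0 G S \<inter> T"
    using X(4) by (auto simp: pointwise_closed_def closedin_closed)
  have "\<exists>u\<in>T. \<forall>k\<in>F. u k = f0 k" if "finite F" for F
  proof -
    have "\<exists>v\<in>?V. \<forall>k\<in>insert \<one> (F \<inter> carrier G). v k = f k"
    proof (rule annihilated_imp_interpolated[OF with_constants_subspace[OF X(2)] _ _ ann])
      show "?V \<subseteq> real_functions G" using with_constants_mem_iff[OF X(1)] by blast
    qed (use that with_constants_translate[OF X(1,3)] in auto)
    then obtain v where v: "v \<in> ?V" "\<And>k. k \<in> insert \<one> (F \<inter> carrier G) \<Longrightarrow> v k = f k" by blast
    let ?u = "\<lambda>k. if k \<in> carrier G then v k - v \<one> else 0"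
    have "?u \<in> X" using v(1) with_constants_mem_iff[OF X(1)] by blast
    then have "?u \<in> T" using T(2) by blast
    moreover have "\<forall>k\<in>F. ?u k = f0 k" using v(2) by (auto simp: f0_def)
    ultimately show ?thesis by (intro bexI[of _ ?u])
  qed
  then have "f0 \<in> T" by (rule closed_contains_finite_interpolated[OF T(1)])
  with f0 T have "f0 \<in> X" by blast
  with f' show ?thesis by (simp add: with_constants_mem_iff[OF X(1)] f0_def)
qed

text \<open>
  For functions vanishing at the identity, membership in \<open>X~\<close> and in \<open>X\<close> coincide, so the
  description of \<open>X~\<close> by kernels restricts to one of \<open>X\<close> inside \<open>Lip0 G S\<close>.
\<close>
lemma common_kernel_pointwise_closed:
  assumes "X \<subseteq> Lip0 G S"
    and eq: "with_constants G X = with_constants G (Lip0 G S) \<inter> (\<Inter>n. kernel_P G (x n))"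
  shows "pointwise_closed G S X"
proof -
  have "X = Lip0 G S \<inter> (\<Inter>n. {f. convolution G f (x n) = 0})"
  proof (rule Set.set_eqI)
    fix f
    show "f \<in> X \<longleftrightarrow> f \<in> Lip0 G S \<inter> (\<Inter>n. {f. convolution G f (x n) = 0})"
    proof (cases "f \<in> Lip0 G S")
      case True
      then have "f \<in> real_functions G" by (simp add: Lip0_def)
      then show ?thesis
        using Lip0_basepoint_iff[OF assms(1) True] Lip0_basepoint_iff[OF order_refl True] True
        by (auto simp: eq kernel_P_def)
    qed (use assms in auto)
  qed
  moreover have "closed (\<Inter>n. {f. convolution G f (x n) = 0})"
    by (intro closed_INT ballI closed_convolution_zero)
  ultimately show ?thesis
    unfolding pointwise_closed_def closedin_closed by blast
qed

end

theorem theorem3p4: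
  fixes G :: "('a, 'b) monoid_scheme" (structure)
    and S :: "'a set"
    and X :: "('a \<Rightarrow> real) set"
  assumes "group G"
    and "infinite (carrier G)"
    and "finite S"
    and "symmetric_generating_set G S"
    and "X \<subseteq> Lip0 G S"
    and "subspace X"
    and "invariant G X"
  shows "pointwise_closed G S X \<longleftrightarrow>
    (\<exists>x :: nat \<Rightarrow> 'a \<Rightarrow> real. (\<forall>n. x n \<in> group_algebra G) \<and>
       with_constants G X = with_constants G (Lip0 G S) \<inter> (\<Inter>n. kernel_P G (x n)))"
proof
  interpret group G by fact
  let ?V = "with_constants G X"
  assume closed: "pointwise_closed G S X"
  have "countable (carrier G)"
    using generate_countable[of S] assms(3,4)
    by (simp add: symmetric_generating_set_def countable_finite)
  moreover have "?V \<subseteq> real_functions G" using with_constants_mem_iff[OF assms(5)] by blast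
  ultimately obtain x :: "nat \<Rightarrow> 'a \<Rightarrow> real"
    where x: "range x \<subseteq> annihilator ?V" "annihilator ?V \<subseteq> span (range x)"
    using group_algebra_countable_span[OF _ annihilator_subspace]
    by (metis (no_types, lifting) annihilator_def mem_Collect_eq subsetI)
  have alg: "x n \<in> group_algebra G" and ker: "?V \<subseteq> kernel_P G (x n)" for n
    using x(1) by (auto simp: annihilator_def)
  have "?V = with_constants G (Lip0 G S) \<inter> (\<Inter>n. kernel_P G (x n))"
  proof (intro equalityI subsetI IntI INT_I)
    fix f assume "f \<in> ?V"
    then show "f \<in> with_constants G (Lip0 G S)"
      using assms(5) with_constants_mem_iff[OF assms(5)] with_constants_mem_iff[OF order_refl] by blast
    show "f \<in> kernel_P G (x n)" for n using ker \<open>f \<in> ?V\<close> by blast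
  next
    fix f assume f: "f \<in> with_constants G (Lip0 G S) \<inter> (\<Inter>n. kernel_P G (x n))"
    \<comment> \<open>By linearity, being killed by every \<open>x n\<close> means being killed by the whole annihilator.\<close>
    have "span (range x) \<subseteq> {x \<in> group_algebra G. convolution G f x = 0}"
      using f alg
      by (intro span_minimal group_algebra_convolution_subspace) (auto simp: kernel_P_def)
    then show "f \<in> ?V"
      using x(2) f closed_invariant_annihilated[OF assms(5-7) closed, of f] by blast
  qed
  with alg show "\<exists>x :: nat \<Rightarrow> 'a \<Rightarrow> real. (\<forall>n. x n \<in> group_algebra G) \<and>
       ?V = with_constants G (Lip0 G S) \<inter> (\<Inter>n. kernel_P G (x n))"
    by (intro exI[of _ x] conjI allI)
next
  interpret group G by fact
  assume "\<exists>x :: nat \<Rightarrow> 'a \<Rightarrow> real. (\<forall>n. x n \<in> group_algebra G) \<and>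
       with_constants G X = with_constants G (Lip0 G S) \<inter> (\<Inter>n. kernel_P G (x n))"
  then obtain x :: "nat \<Rightarrow> 'a \<Rightarrow> real"
    where "with_constants G X = with_constants G (Lip0 G S) \<inter> (\<Inter>n. kernel_P G (x n))"
    by (elim exE conjE)
  then show "pointwise_closed G S X"
    by (rule common_kernel_pointwise_closed[OF assms(5)])
qed

end
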